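(* $\ell(4) = 360$. That is, there is a covering system consisting of one congruence for each divisor $d$ of $360$ with $d \ge 4$ (the divisor $d$ being its modulus), and for every positive integer $m < 360$ there is no covering system consisting of one congruence for each divisor $d$ of $m$ with $d \ge 4$.
   Context: A covering system (covering) is a finite set of congruences $\{x \equiv r_i \pmod{n_i}\}$ with positive integer moduli such that every integer satisfies at least one of them. For an integer $n\ge 2$, $\ell(n)$ denotes the least positive integer such that there exists a covering whose moduli are exactly the divisors of $\ell(n)$ which are at least $n$, each used once. *)

theory Defs
  imports "HOL-Number_Theory.Cong"
begin

text \<open>A pair \<open>(r, n)\<close> stands for the congruence \<open>x \<equiv> r (mod n)\<close>.\<close>

definition covering_system :: "(int \<times> nat) set \<Rightarrow> bool" where
  "covering_system C \<longleftrightarrow>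
     finite C \<and> (\<forall>(r, n) \<in> C. n > 0) \<and>
     (\<forall>x::int. \<exists>(r, n) \<in> C. [x = r] (mod int n))"

text \<open>
  That \<open>snd\<close> is a bijection onto the divisors says that the moduli are exactly
  these divisors and that each of them is used once.
\<close>

definition divisor_covering :: "nat \<Rightarrow> nat \<Rightarrow> (int \<times> nat) set \<Rightarrow> bool" where
  "divisor_covering n m C \<longleftrightarrow>
     covering_system C \<and> bij_betw snd C {d. d dvd m \<and> n \<le> d}"

text \<open>
  \<open>LEAST\<close> is meaningful only if a suitable \<open>m\<close> exists; claims about \<open>ell n\<close> should
  therefore be accompanied by the existence of a covering.
\<close>

definition ell :: "nat \<Rightarrow> nat" where
  "ell n = (LEAST m. m > 0 \<and> (\<exists>C. divisor_covering n m C))"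

end

theory Submission
  imports Defs "HOL-Library.Code_Binary_Nat"
begin

text \<open>
  A covering by the divisors of \<open>m\<close> yields one by the divisors of any multiple of \<open>m\<close>, so for
  the lower bound it suffices to treat \<open>180 \<le> m < 360\<close>. There the residues are chosen one modulus
  at a time. The set left uncovered after some steps is periodic modulo the lcm \<open>t\<close> of the
  moduli used so far; a branch dies as soon as the largest densities that the remaining moduli
  can each take from this set do not add up to its density. Since the uncovered set is invariant under
  translation by \<open>t\<close>, the residue of the next modulus \<open>d\<close> may be assumed to be less than
  \<open>gcd d t\<close>. For most \<open>m\<close> the bound already applies at the root (the sum of the reciprocals of
  the moduli is less than 1), and the search is tiny for every \<open>m\<close> except 240.
\<close>

section \<open>Coverings as residue functions\<close>

text \<open>Since \<open>snd\<close> is injective on a covering, each modulus carries one residue,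
  and a covering amounts to a residue function \<open>a\<close> on the admissible divisors. Its
  values elsewhere are arbitrary.\<close>

lemma ex_divisor_covering_iff:
  assumes "0 < n" "0 < m"
  shows "(\<exists>C. divisor_covering n m C) \<longleftrightarrow>
    (\<exists>a. \<forall>x::int. \<exists>d. d dvd m \<and> n \<le> d \<and> [x = a d] (mod int d))"
proof
  assume "\<exists>C. divisor_covering n m C"
  then obtain C where cov: "\<And>x::int. \<exists>(r, d) \<in> C. [x = r] (mod int d)"
    and bij: "bij_betw snd C {d. d dvd m \<and> n \<le> d}"
    by (auto simp: divisor_covering_def covering_system_def)
  have "\<exists>d. d dvd m \<and> n \<le> d \<and> [x = fst (inv_into C snd d)] (mod int d)" for x
  proof -
    obtain r d where rd: "(r, d) \<in> C" "[x = r] (mod int d)"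
      using cov[of x] by auto
    have "inv_into C snd d = (r, d)"
      using bij_betw_inv_into_left[OF bij rd(1)] by simp
    moreover have "d dvd m \<and> n \<le> d"
      using bij_betwE[OF bij] rd(1) by force
    ultimately show ?thesis
      using rd(2) by (intro exI[of _ d]) simp
  qed
  then show "\<exists>a. \<forall>x::int. \<exists>d. d dvd m \<and> n \<le> d \<and> [x = a d] (mod int d)"
    by (intro exI[of _ "\<lambda>d. fst (inv_into C snd d)"]) blast
next
  assume "\<exists>a. \<forall>x::int. \<exists>d. d dvd m \<and> n \<le> d \<and> [x = a d] (mod int d)"
  then obtain a where a: "\<And>x::int. \<exists>d. d dvd m \<and> n \<le> d \<and> [x = a d] (mod int d)"
    by blast
  define D where "D = {d. d dvd m \<and> n \<le> d}"
  have "finite D"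
    using assms(2) by (auto simp: D_def)
  moreover have "bij_betw snd ((\<lambda>d. (a d, d)) ` D) D"
    by (rule bij_betw_byWitness[where f' = "\<lambda>d. (a d, d)"]) auto
  ultimately have "divisor_covering n m ((\<lambda>d. (a d, d)) ` D)"
    using a assms(1) by (fastforce simp: divisor_covering_def covering_system_def D_def)
  then show "\<exists>C. divisor_covering n m C" ..
qed

text \<open>The same residue function works: the divisors of \<open>m\<close> keep their residues,
  and the additional divisors of \<open>m'\<close> may carry any.\<close>

lemma ex_divisor_covering_dvd:
  assumes "0 < n" "0 < m'" "m dvd m'" "\<exists>C. divisor_covering n m C"
  shows "\<exists>C. divisor_covering n m' C"
proof -
  have "0 < m"
    using assms(2,3) by (rule dvd_pos_nat)
  with assms show ?thesis
    by (meson ex_divisor_covering_iff dvd_trans)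
qed

section \<open>The branch and bound search\<close>

text \<open>
  In both functions \<open>xs\<close> has length \<open>k * d\<close> and is processed in \<open>k\<close> blocks of length \<open>d\<close>.
\<close>

fun class_sums :: "nat \<Rightarrow> nat \<Rightarrow> nat list \<Rightarrow> nat list" where
  "class_sums d 0 xs = replicate d 0"
| "class_sums d (Suc k) xs = map2 (+) (take d xs) (class_sums d k (drop d xs))"

fun clear_class :: "nat \<Rightarrow> nat \<Rightarrow> nat list \<Rightarrow> nat \<Rightarrow> nat list" where
  "clear_class d 0 xs r = []"
| "clear_class d (Suc k) xs r = (take d xs)[r := 0] @ clear_class d k (drop d xs) r"

text \<open>By the Chinese remainder theorem, a class modulo \<open>d\<close> meets a
  \<open>t\<close>-periodic set, within one period \<open>lcm d t\<close>, in as many points as some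
  class modulo \<open>gcd d t\<close> does within one period \<open>t\<close>. The last factor
  rescales the maximum to \<open>L\<close>.\<close>

definition class_bound :: "nat \<Rightarrow> nat \<Rightarrow> nat list \<Rightarrow> nat \<Rightarrow> nat" where
  "class_bound L t xs d = fold max (class_sums (gcd d t) (t div gcd d t) xs) 0 * (L div lcm d t)"

text \<open>
  The list \<open>xs\<close> of length \<open>t\<close> is the 0-1 indicator of the uncovered residues modulo \<open>t\<close>, and \<open>ds\<close>
  are the moduli still to be used; elements are counted modulo \<open>L\<close>. The higher-order arguments
  are partial applications rather than abstractions because \<open>code_simp\<close> would simplify the
  body of an abstraction.
\<close>

fun refutes :: "nat \<Rightarrow> nat \<Rightarrow> nat list \<Rightarrow> nat list \<Rightarrow> bool" where
  "refutes L t [] xs \<longleftrightarrow> 0 < sum_list xs * (L div t)"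
| "refutes L t (d # ds) xs \<longleftrightarrow>
     sum_list (map (class_bound L t xs) (d # ds)) < sum_list xs * (L div t) \<or>
     list_all (refutes L (lcm d t) ds)
       (map (clear_class d (lcm d t div d) (concat (replicate (lcm d t div t) xs))) [0..<gcd d t])"

section \<open>Block operations on lists given by functions of the position\<close>

lemma take_drop_map_upt:
  fixes f :: "nat \<Rightarrow> 'a"
  shows "take d (map f [0..<d + n]) = map f [0..<d]"
    and "drop d (map f [0..<d + n]) = map (\<lambda>x. f (d + x)) [0..<n]"
  by (auto intro!: nth_equalityI)

lemma class_sums_map:
  "class_sums d k (map f [0..<k * d]) = map (\<lambda>r. \<Sum>i<k. f (i * d + r)) [0..<d]"
proof (induction k arbitrary: f)
  case 0
  show ?case by (simp add: map_replicate_const)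
next
  case (Suc k)
  have "class_sums d (Suc k) (map f [0..<Suc k * d]) =
      map2 (+) (map f [0..<d]) (map (\<lambda>r. \<Sum>i<k. f (d + (i * d + r))) [0..<d])"
    by (simp add: take_drop_map_upt Suc.IH del: map_map)
  also have "\<dots> = map (\<lambda>r. f r + (\<Sum>i<k. f (d + (i * d + r)))) [0..<d]"
    by (auto intro!: nth_equalityI)
  also have "\<dots> = map (\<lambda>r. \<Sum>i<Suc k. f (i * d + r)) [0..<d]"
    by (simp add: sum.lessThan_Suc_shift add.assoc del: sum.lessThan_Suc)
  finally show ?case .
qed

lemma clear_class_map:
  assumes "r < d"
  shows "clear_class d k (map f [0..<k * d]) r =
    map (\<lambda>x. if x mod d = r then 0 else f x) [0..<k * d]"
proof (induction k arbitrary: f)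
  case 0
  show ?case by simp
next
  case (Suc k)
  have "clear_class d (Suc k) (map f [0..<Suc k * d]) r =
      (map f [0..<d])[r := 0] @
      map (\<lambda>x. if x mod d = r then 0 else f (d + x)) [0..<k * d]"
    by (simp add: take_drop_map_upt Suc.IH del: map_map)
  also have "(map f [0..<d])[r := 0] = map (\<lambda>x. if x mod d = r then 0 else f x) [0..<d]"
    using assms by (auto intro!: nth_equalityI simp: nth_list_update)
  also have "\<dots> @ map (\<lambda>x. if x mod d = r then 0 else f (d + x)) [0..<k * d] =
      map (\<lambda>x. if x mod d = r then 0 else f x) [0..<d + k * d]"
    by (auto intro!: nth_equalityI simp: nth_append le_mod_geq)
  finally show ?case by simp
qed

lemma concat_replicate_map_upt:
  "concat (replicate k (map f [0..<t])) = map (\<lambda>x. f (x mod t)) [0..<k * t]"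
proof (induction k)
  case 0
  show ?case by simp
next
  case (Suc k)
  have "concat (replicate (Suc k) (map f [0..<t])) =
      map f [0..<t] @ map (\<lambda>x. f (x mod t)) [0..<k * t]"
    by (simp add: Suc.IH)
  also have "\<dots> = map (\<lambda>x. f (x mod t)) [0..<t + k * t]"
    by (auto intro!: nth_equalityI simp: nth_append le_mod_geq)
  finally show ?case by simp
qed

lemma le_fold_max:
  fixes x :: "'a::linorder"
  shows "x \<in> set xs \<Longrightarrow> x \<le> fold max xs b"
  using Max_ge[of "insert b (set xs)" x] by (simp add: Max.set_eq_fold[symmetric])

text \<open>Each block of \<open>d\<close> consecutive indices, starting at a multiple of
  \<open>d\<close>, contains exactly one index of residue \<open>r\<close>.\<close>

lemma sum_residue_class:
  fixes f :: "nat \<Rightarrow> nat"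
  assumes "r < d"
  shows "(\<Sum>x<k * d. if x mod d = r then f x else 0) = (\<Sum>i<k. f (i * d + r))"
proof -
  have "(\<Sum>x=i * d..<i * d + d. if x mod d = r then f x else 0) = f (i * d + r)" for i
  proof -
    have "(\<Sum>x=i * d..<i * d + d. if x mod d = r then f x else 0) =
        (\<Sum>x=i * d..<i * d + d. if x = i * d + r then f x else 0)"
    proof (rule sum.cong)
      fix x assume "x \<in> {i * d..<i * d + d}"
      then obtain y where "x = i * d + y" "y < d"
        by (metis add_less_cancel_left atLeastLessThan_iff le_Suc_ex)
      then show "(if x mod d = r then f x else 0) = (if x = i * d + r then f x else 0)"
        by simp
    qed simp
    also have "\<dots> = f (i * d + r)"
      using assms by simp
    finally show ?thesis .
  qed
  then show ?thesis
    by (simp flip: sum.nat_group)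
qed

section \<open>Soundness of the search\<close>

abbreviation indicator_list :: "int set \<Rightarrow> nat \<Rightarrow> nat list" where
  "indicator_list U t \<equiv> map (\<lambda>x. of_bool (int x \<in> U)) [0..<t]"

definition periodic :: "int set \<Rightarrow> nat \<Rightarrow> bool" where
  "periodic U t \<longleftrightarrow> (\<forall>x. x \<in> U \<longleftrightarrow> x mod int t \<in> U)"

lemma periodicD: "periodic U t \<Longrightarrow> x \<in> U \<longleftrightarrow> x mod int t \<in> U"
  by (auto simp: periodic_def)

lemma periodic_translate: "periodic U t \<Longrightarrow> x + k * int t \<in> U \<longleftrightarrow> x \<in> U"
  by (metis periodicD mod_mult_self1)

lemma periodic_dvd:
  assumes "periodic U t" "t dvd t'"
  shows "periodic U t'"
  unfolding periodic_def
proof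
  fix x
  have "x mod int t' mod int t = x mod int t"
    using assms(2) by (simp add: mod_mod_cancel)
  then show "x \<in> U \<longleftrightarrow> x mod int t' \<in> U"
    by (metis assms(1) periodicD)
qed

lemma periodic_Diff_class:
  assumes "periodic U t"
  shows "periodic {x \<in> U. x mod int d \<noteq> r} (lcm d t)"
proof -
  have "periodic U (lcm d t)"
    using assms by (rule periodic_dvd) simp
  moreover have "x mod int (lcm d t) mod int d = x mod int d" for x
    by (rule mod_mod_cancel) simp
  ultimately show ?thesis
    by (auto simp: periodic_def)
qed

section \<open>Counting points of periodic sets\<close>

lemma card_eq_sum_list_indicator:
  "card {x. x < t \<and> int x \<in> U} = sum_list (indicator_list U t)"
proof -
  have "sum_list (indicator_list U t) = (\<Sum>x\<in>{..<t}. of_bool (int x \<in> U))"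
    by (simp add: interv_sum_list_conv_sum_set_nat lessThan_atLeast0)
  also have "\<dots> = card {x. x < t \<and> int x \<in> U}"
    by (simp add: Int_def)
  finally show ?thesis ..
qed

lemma card_periodic:
  assumes "periodic U t" "t dvd L"
  shows "card {x. x < L \<and> int x \<in> U} = sum_list (indicator_list U t) * (L div t)"
proof -
  define k where "k = L div t"
  have L: "L = k * t"
    using assms(2) by (simp add: k_def)
  have per: "int (x mod t) \<in> U \<longleftrightarrow> int x \<in> U" for x
    using periodicD[OF assms(1), of "int x"] by (simp add: zmod_int)
  have "sum_list (concat (replicate k (indicator_list U t))) = sum_list (indicator_list U t) * k"
    by (induction k) simp_all
  moreover have "concat (replicate k (indicator_list U t)) = indicator_list U L"
    unfolding concat_replicate_map_upt L by (simp add: per)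
  ultimately show ?thesis
    by (simp add: card_eq_sum_list_indicator k_def)
qed

lemma card_class_le_fold_max:
  assumes "0 < g" "g dvd t"
  shows "card {i. i < t \<and> int i \<in> U \<and> i mod g = r} \<le>
    fold max (class_sums g (t div g) (indicator_list U t)) 0"
proof (cases "r < g")
  case True
  define k where "k = t div g"
  have t: "t = k * g"
    using assms(2) by (simp add: k_def)
  have "card {i. i < t \<and> int i \<in> U \<and> i mod g = r} =
      (\<Sum>x<k * g. if x mod g = r then of_bool (int x \<in> U) else 0)"
  proof -
    have "(\<Sum>x<k * g. if x mod g = r then of_bool (int x \<in> U) else 0) =
        (\<Sum>x<k * g. of_bool (int x \<in> U \<and> x mod g = r) :: nat)"
      by (intro sum.cong) auto
    also have "\<dots> = card {i. i < t \<and> int i \<in> U \<and> i mod g = r}"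
      by (simp add: Int_def t)
    finally show ?thesis ..
  qed
  also have "\<dots> = (\<Sum>i<k. of_bool (int (i * g + r) \<in> U))"
    by (rule sum_residue_class[OF True])
  also have "\<dots> \<in> set (class_sums g k (indicator_list U t))"
    using True by (auto simp: t class_sums_map simp del: of_nat_add of_nat_mult)
  then have "(\<Sum>i<k. of_bool (int (i * g + r) \<in> U)) \<le> fold max (class_sums g k (indicator_list U t)) 0"
    by (rule le_fold_max)
  finally show ?thesis
    by (simp add: k_def)
next
  case False
  then have "i mod g \<noteq> r" for i
    using assms(1) mod_less_divisor by blast
  then show ?thesis by simp
qed

text \<open>A point of the class is determined by its residue modulo \<open>t\<close> and the block
  of length \<open>lcm d t\<close> that contains it. That residue lies in one fixed class modulo
  \<open>gcd d t\<close>.\<close>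

lemma card_class_le_class_bound:
  assumes "periodic U t" "0 < t" "0 < d" "lcm d t dvd L"
  shows "card {x. x < L \<and> int x \<in> U \<and> [int x = a] (mod int d)} \<le>
    class_bound L t (indicator_list U t) d"
proof -
  let ?g = "gcd d t" and ?M = "lcm d t"
  let ?A = "{x. x < L \<and> int x \<in> U \<and> [int x = a] (mod int d)}"
  define r where "r = nat (a mod int ?g)"
  let ?B = "{i. i < t \<and> int i \<in> U \<and> i mod ?g = r}"
  have inj: "inj_on (\<lambda>x. (x mod t, x div ?M)) ?A"
  proof (rule inj_onI)
    fix x y assume x: "x \<in> ?A" and y: "y \<in> ?A" and xy: "(x mod t, x div ?M) = (y mod t, y div ?M)"
    have "[int x = int y] (mod int d)"
      using x y by (auto intro: cong_trans cong_sym)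
    then have "[x = y] (mod d)"
      by (simp add: cong_int_iff)
    moreover have "[x = y] (mod t)"
      using xy by (simp add: cong_def)
    ultimately have "[x = y] (mod ?M)"
      by (metis cong_cong_lcm_nat)
    with xy show "x = y"
      by (metis cong_def div_mult_mod_eq prod.inject)
  qed
  have "(\<lambda>x. (x mod t, x div ?M)) ` ?A \<subseteq> ?B \<times> {..<L div ?M}"
  proof (rule image_subsetI)
    fix x assume "x \<in> ?A"
    then have x: "x < L" "int x \<in> U" "[int x = a] (mod int d)"
      by auto
    have "int x mod int ?g = a mod int ?g"
      using cong_dvd_modulus[OF x(3), of "int ?g"] by (simp add: cong_def)
    then have "x mod ?g = r"
      by (simp add: r_def flip: zmod_int)
    then have "x mod t mod ?g = r"
      by (simp add: mod_mod_cancel)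
    moreover have "int (x mod t) \<in> U"
      using periodicD[OF assms(1), of "int x"] x(2) by (simp add: zmod_int)
    moreover have "x div ?M < L div ?M"
      using x(1) assms(4) by (intro less_mult_imp_div_less) (simp only: dvd_div_mult_self)
    ultimately show "(x mod t, x div ?M) \<in> ?B \<times> {..<L div ?M}"
      using assms(2) by auto
  qed
  then have "card ?A \<le> card (?B \<times> {..<L div ?M})"
    by (intro card_inj_on_le[OF inj]) auto
  also have "\<dots> = card ?B * (L div ?M)"
    by (simp add: card_cartesian_product)
  also have "\<dots> \<le> class_bound L t (indicator_list U t) d"
    unfolding class_bound_def using assms(2)
    by (intro mult_right_mono card_class_le_fold_max) auto
  finally show ?thesis .
qed

lemma card_UN_list_le:
  assumes "\<And>d. d \<in> set ds \<Longrightarrow> card (B d) \<le> f d"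
  shows "card (\<Union>d\<in>set ds. B d) \<le> sum_list (map f ds)"
  using assms
proof (induction ds)
  case (Cons d ds)
  then have "card (B d) + card (\<Union>e\<in>set ds. B e) \<le> f d + sum_list (map f ds)"
    by (intro add_mono) auto
  with card_Un_le[of "B d" "\<Union>e\<in>set ds. B e"] show ?case
    by simp
qed simp

text \<open>The union bound, counted modulo \<open>L\<close>. Its contrapositive justifies cutting
  off a branch.\<close>

lemma card_covered_le:
  assumes "periodic U t" "0 < t" "0 < L" "t dvd L"
    and "\<And>d. d \<in> set ds \<Longrightarrow> d dvd L"
    and cov: "\<And>x. x \<in> U \<Longrightarrow> \<exists>d\<in>set ds. [x = a d] (mod int d)"
  shows "sum_list (indicator_list U t) * (L div t) \<le>
    sum_list (map (class_bound L t (indicator_list U t)) ds)"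
proof -
  let ?B = "\<lambda>d. {x. x < L \<and> int x \<in> U \<and> [int x = a d] (mod int d)}"
  have "{x. x < L \<and> int x \<in> U} = (\<Union>d\<in>set ds. ?B d)"
    using cov by auto
  moreover have "card (?B d) \<le> class_bound L t (indicator_list U t) d" if "d \<in> set ds" for d
  proof (rule card_class_le_class_bound)
    show "0 < d"
      using dvd_pos_nat[OF assms(3) assms(5)[OF that]] .
    show "lcm d t dvd L"
      using assms(4,5) that by simp
  qed (use assms in auto)
  ultimately show ?thesis
    using card_UN_list_le[of ds ?B] by (simp flip: card_periodic[OF assms(1,4)])
qed

text \<open>By Bezout, translations by multiples of \<open>t\<close> move a residue modulo
  \<open>d\<close> by every multiple of \<open>gcd d t\<close>.\<close>

lemma ex_translate_mod_less_gcd: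
  fixes a :: int
  assumes "0 < d"
  obtains k :: int and r where "r < gcd d t" "[a + k * int t = int r] (mod int d)"
proof -
  let ?g = "gcd (int d) (int t)"
  obtain u v where uv: "u * int d + v * int t = ?g"
    using bezout_int by blast
  \<comment> \<open>With this \<open>k\<close>, \<open>a + k * int t\<close> exceeds
    \<open>a mod ?g\<close> by \<open>(a div ?g) * u * int d\<close>.\<close>
  define k where "k = - v * (a div ?g)"
  have g: "?g = int (gcd d t)" "0 < ?g"
    using assms by simp_all
  have "a + k * int t = a mod ?g + (a div ?g) * (?g - v * int t)"
    by (simp add: k_def algebra_simps)
  also have "?g - v * int t = u * int d"
    using uv by linarith
  finally have "[a + k * int t = a mod ?g] (mod int d)"
    by (simp add: cong_def mult.assoc[symmetric] del: gcd_int_int_eq)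
  moreover have "0 \<le> a mod ?g" "a mod ?g < ?g"
    using g(2) by simp_all
  ultimately show ?thesis
    using g(1) by (intro that[of "nat (a mod ?g)" k]) auto
qed

text \<open>Repetition extends the list to the period \<open>lcm d t\<close>, a multiple of
  \<open>d\<close>, where the class modulo \<open>d\<close> can be cleared block by block.\<close>

lemma clear_class_indicator_list:
  assumes "periodic U t" "r < d"
  shows "clear_class d (lcm d t div d) (concat (replicate (lcm d t div t) (indicator_list U t))) r =
    indicator_list {x \<in> U. x mod int d \<noteq> int r} (lcm d t)"
proof -
  have "int (x mod t) \<in> U \<longleftrightarrow> int x \<in> U" for x
    using periodicD[OF assms(1), of "int x"] by (simp add: zmod_int)
  then have "concat (replicate (lcm d t div t) (indicator_list U t)) =
      indicator_list U (lcm d t div d * d)"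
    unfolding concat_replicate_map_upt by simp
  moreover have "(if x mod d = r then 0 else of_bool (int x \<in> U)) =
      (of_bool (int x \<in> {x \<in> U. x mod int d \<noteq> int r}) :: nat)" for x
    by (simp flip: zmod_int)
  ultimately have "clear_class d (lcm d t div d) (concat (replicate (lcm d t div t) (indicator_list U t))) r =
      indicator_list {x \<in> U. x mod int d \<noteq> int r} (lcm d t div d * d)"
    by (simp only: clear_class_map[OF assms(2)])
  then show ?thesis
    by simp
qed

lemma refutes_sound:
  assumes "refutes L t ds (indicator_list U t)"
    and "periodic U t" "0 < t" "0 < L" "t dvd L" "\<And>d. d \<in> set ds \<Longrightarrow> d dvd L"
  shows "\<exists>x\<in>U. \<forall>d\<in>set ds. \<not> [x = a d] (mod int d)"
  using assms
\<comment> \<open>The residues \<open>a\<close> must vary as well: normalizing the residue of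
  \<open>d\<close> by a translation shifts those of all later moduli.\<close>
proof (induction ds arbitrary: t U a)
  case Nil
  have "\<not> sum_list (indicator_list U t) * (L div t) \<le> 0"
    using Nil.prems(1) by (simp only: refutes.simps not_le)
  then have "U \<noteq> {}"
    by (auto simp: sum_list_eq_0_iff)
  then show ?case
    by auto
next
  case (Cons d ds)
  show ?case
  proof (cases "sum_list (map (class_bound L t (indicator_list U t)) (d # ds)) <
      sum_list (indicator_list U t) * (L div t)")
    case True
    show ?thesis
    proof (rule ccontr)
      assume "\<not> ?thesis"
      then have "\<And>x. x \<in> U \<Longrightarrow> \<exists>d\<in>set (d # ds). [x = a d] (mod int d)"
        by blast
      with Cons.prems(2-6)
      have "sum_list (indicator_list U t) * (L div t) \<le>
          sum_list (map (class_bound L t (indicator_list U t)) (d # ds))"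
        by (rule card_covered_le)
      from leD[OF this] True show False
        by (rule notE)
    qed
  next
    case False
    have "0 < d"
      using dvd_pos_nat[OF Cons.prems(4) Cons.prems(6)[of d]] by simp
    then obtain k r where r: "r < gcd d t" and k: "[a d + k * int t = int r] (mod int d)"
      by (rule ex_translate_mod_less_gcd)
    have "r < d"
      using r gcd_le1_nat[of d t] \<open>0 < d\<close> by linarith
    let ?U = "{x \<in> U. x mod int d \<noteq> int r}"
    have "refutes L (lcm d t) ds (indicator_list ?U (lcm d t))"
    proof -
      have "list_all (refutes L (lcm d t) ds) (map (clear_class d (lcm d t div d)
          (concat (replicate (lcm d t div t) (indicator_list U t)))) [0..<gcd d t])"
        using Cons.prems(1) False unfolding refutes.simps by blast
      then show ?thesis
        using r unfolding list_all_iff clear_class_indicator_list[OF Cons.prems(2) \<open>r < d\<close>, symmetric]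
        by simp
    qed
    moreover have "0 < lcm d t"
      using \<open>0 < d\<close> Cons.prems(3) by (simp add: lcm_pos_nat)
    ultimately obtain x where x: "x \<in> ?U" "\<And>e. e \<in> set ds \<Longrightarrow> \<not> [x = a e + k * int t] (mod int e)"
      using Cons.IH[of "lcm d t" ?U "\<lambda>e. a e + k * int t"] Cons.prems
        periodic_Diff_class[OF Cons.prems(2), of d "int r"] by auto
    \<comment> \<open>The point \<open>x\<close> avoids the translated classes; translated back, it
      avoids the original ones and stays in \<open>U\<close> because \<open>U\<close> has period
      \<open>t\<close>.\<close>
    have shift: "[x - k * int t = b] (mod int e) \<longleftrightarrow> [x = b + k * int t] (mod int e)" for b e
      by (simp add: cong_iff_dvd_diff algebra_simps)
    have "\<not> [x = a d + k * int t] (mod int d)"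
    proof
      assume "[x = a d + k * int t] (mod int d)"
      then have "[x = int r] (mod int d)"
        using k by (rule cong_trans)
      then show False
        using x(1) \<open>r < d\<close> by (simp add: cong_def)
    qed
    moreover have "x - k * int t \<in> U"
      using periodic_translate[OF Cons.prems(2), of x "- k"] x(1) by simp
    ultimately show ?thesis
      using x(2) by (intro bexI[of _ "x - k * int t"]) (auto simp: shift)
  qed
qed

text \<open>The search starts with every integer uncovered, a set of period 1 with indicator list
  \<open>[1]\<close>. All moduli divide \<open>m\<close>, so points are counted modulo
  \<open>m\<close>.\<close>

lemma no_divisor_covering_if_refutes:
  assumes "0 < n" "0 < m" "set ds = {d. d dvd m \<and> n \<le> d}" "refutes m 1 ds [1]"
  shows "\<not> (\<exists>C. divisor_covering n m C)"
proof
  assume "\<exists>C. divisor_covering n m C"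
  then obtain a where a: "\<And>x::int. \<exists>d\<in>set ds. [x = a d] (mod int d)"
    using assms by (auto simp: ex_divisor_covering_iff)
  have "refutes m 1 ds (indicator_list UNIV 1)"
    using assms(4) by simp
  then have "\<exists>x\<in>UNIV. \<forall>d\<in>set ds. \<not> [x = a d] (mod int d)"
    by (rule refutes_sound) (use assms in \<open>auto simp: periodic_def\<close>)
  with a show False by blast
qed

section \<open>The computations\<close>

text \<open>Named, with \<open>m\<close> first, so that \<open>filter\<close> receives a partial
  application.\<close>

definition has_divisor :: "nat \<Rightarrow> nat \<Rightarrow> bool" where
  "has_divisor m d \<longleftrightarrow> d dvd m"

definition divisors_from :: "nat \<Rightarrow> nat \<Rightarrow> nat list" where
  "divisors_from n m = filter (has_divisor m) [n..<Suc m]"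

lemma set_divisors_from: "0 < m \<Longrightarrow> set (divisors_from n m) = {d. d dvd m \<and> n \<le> d}"
  by (auto simp: divisors_from_def has_divisor_def dest: dvd_imp_le)

definition refuted :: "nat \<Rightarrow> bool" where
  "refuted m \<longleftrightarrow> refutes m 1 (divisors_from 4 m) [1]"

lemma refuted_180_240: "list_all refuted [180..<240]"
  by code_simp

lemma refuted_241_360: "list_all refuted [241..<360]"
  by code_simp

text \<open>
  For 240 the increasing order of the moduli is inefficient. With 5 after the divisors of 48, all
  but eight nodes of the search tree have period dividing 48.
\<close>

lemma refutes_240:
  "refutes 240 1 [4, 6, 8, 12, 16, 24, 5, 10, 15, 20, 30, 40, 48, 60, 80, 120, 240] [1]"
  by code_simp

lemma divisors_240:
  "set [4, 6, 8, 12, 16, 24, 5, 10, 15, 20, 30, 40, 48, 60, 80, 120, 240] =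
    set (divisors_from 4 240)"
  by code_simp

lemma no_divisor_covering_4:
  assumes "0 < m" "m < 360"
  shows "\<not> (\<exists>C. divisor_covering 4 m C)"
proof -
  have large: "\<not> (\<exists>C. divisor_covering 4 m C)" if "180 \<le> m" "m < 360" for m
  proof (cases "m = 240")
    case True
    moreover have "\<not> (\<exists>C. divisor_covering 4 240 C)"
      by (rule no_divisor_covering_if_refutes[OF _ _ trans[OF divisors_240 set_divisors_from] refutes_240])
        simp_all
    ultimately show ?thesis by simp
  next
    case False
    then have "m \<in> set [180..<240] \<or> m \<in> set [241..<360]"
      unfolding set_upt atLeastLessThan_iff using that by linarith
    then have "refuted m"
      using refuted_180_240 refuted_241_360 unfolding list_all_iff by blast
    then show ?thesis
      unfolding refuted_def
      using that by (intro no_divisor_covering_if_refutes[OF _ _ set_divisors_from]) auto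
  qed
  \<comment> \<open>The largest multiple of \<open>m\<close> below 360 is \<open>k * m\<close>. It
    is at least 180, as the remainder is less than \<open>m \<le> k * m\<close> and hence
    \<open>359 < 2 * (k * m)\<close>.\<close>
  define k where "k = 359 div m"
  have "k * m + 359 mod m = 359" "359 mod m < m"
    using assms(1) by (simp_all add: k_def)
  moreover have "m \<le> k * m"
    using assms by (simp add: k_def div_greater_zero_iff Suc_le_eq)
  ultimately have "180 \<le> k * m" "k * m < 360"
    by linarith+
  then show ?thesis
    using large[of "k * m"] ex_divisor_covering_dvd[of 4 "k * m" m] by fastforce
qed

section \<open>An explicit covering for 360\<close>

definition residues_360 :: "(nat \<times> nat) list" where
  "residues_360 =
    [(4, 3), (5, 4), (6, 2), (8, 1), (9, 0), (10, 8), (12, 4), (15, 10), (18, 12), (20, 13),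
     (24, 5), (30, 16), (36, 6), (40, 21), (45, 42), (60, 22), (72, 21), (90, 60), (120, 37),
     (180, 96), (360, 285)]"

text \<open>Pairs here have the modulus first, unlike in \<open>covering_system\<close>. The
  residues in \<open>residues_360\<close> are reduced, so equality with the remainder tests
  congruence.\<close>

definition in_class :: "nat \<Rightarrow> nat \<times> nat \<Rightarrow> bool" where
  "in_class x p \<longleftrightarrow> x mod fst p = snd p"

definition covered_360 :: "nat \<Rightarrow> bool" where
  "covered_360 x \<longleftrightarrow> list_ex (in_class x) residues_360"

lemma covered_360: "list_all covered_360 [0..<360]"
  by code_simp

lemma moduli_360: "map fst residues_360 = divisors_from 4 360"
  by code_simp

lemma ex_divisor_covering_360: "\<exists>C. divisor_covering 4 360 C"
proof -
  define a where "a d = int (the (map_of residues_360 d))" for d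
  have "\<exists>d. d dvd 360 \<and> 4 \<le> d \<and> [x = a d] (mod int d)" for x :: int
  proof -
    \<comment> \<open>All moduli divide 360, so the finite check on residues modulo 360 decides
      coverage of \<open>x\<close>.\<close>
    define y where "y = nat (x mod 360)"
    have "y \<in> set [0..<360]"
      by (simp add: y_def nat_less_iff)
    then have "covered_360 y"
      using covered_360 unfolding list_all_iff by blast
    then obtain d r where dr: "(d, r) \<in> set residues_360" "y mod d = r"
      unfolding covered_360_def list_ex_iff in_class_def by auto
    have "d \<in> set (map fst residues_360)"
      using dr(1) by force
    then have d: "d dvd 360" "4 \<le> d"
      by (simp_all add: moduli_360 set_divisors_from)
    \<comment> \<open>Distinct moduli ensure that \<open>map_of\<close> returns the residue of the
      pair found.\<close>
    have "distinct (map fst residues_360)"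
      by (simp only: moduli_360 divisors_from_def distinct_filter distinct_upt)
    then have "a d = int r"
      using dr(1) by (simp add: a_def)
    moreover have "x mod int d = x mod 360 mod int d"
      using d(1) by (metis int_dvd_int_iff mod_mod_cancel of_nat_numeral)
    ultimately have "[x = a d] (mod int d)"
      using dr(2) by (auto simp: cong_def y_def zmod_int)
    with d show ?thesis by blast
  qed
  then show ?thesis
    by (subst ex_divisor_covering_iff) auto
qed

theorem theorem4:
  shows "ell 4 = 360 \<and>
    (\<exists>C. divisor_covering 4 360 C) \<and>
    (\<forall>m. 0 < m \<and> m < 360 \<longrightarrow> \<not> (\<exists>C. divisor_covering 4 m C))"
proof -
  have "ell 4 = 360"
    unfolding ell_def
  proof (rule Least_equality)
    show "0 < (360::nat) \<and> (\<exists>C. divisor_covering 4 360 C)"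
      using ex_divisor_covering_360 by simp
  next
    fix m assume "0 < m \<and> (\<exists>C. divisor_covering 4 m C)"
    then show "360 \<le> m"
      using no_divisor_covering_4[of m] by (meson not_le)
  qed
  then show ?thesis
    using ex_divisor_covering_360 no_divisor_covering_4 by blast
qed

end
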